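(* For every integer $s\ge 4$, one has $$\Pi_{T_s+4}=\{(2,1),(1,2)\},$$ and $$|M^{(2,1)}_{T_s+4}|=|M^{(1,2)}_{T_s+4}|=1.$$ Hence $|M_{T_s+4}|=2$ and $m^{\mathrm{sc}}_{T_s+4}=0$.
   Context: For an integer $m\ge 0$, $T_m:=m(m+1)/2$. Compressed form: a partition $\lambda$ is written $\lambda=(L_1^{m_1},\dots,L_r^{m_r})$ with $L_1>\cdots>L_r>0$ its distinct part sizes and $m_i\ge 1$ the multiplicity of $L_i$. Gaps: $g_i=L_i-L_{i+1}$ for $1\le i<r$ and $g_r=L_r$. Set $A(\lambda):=\#\{i:g_i>1\}$ and $B(\lambda):=\#\{i:m_i>1\}$. Partition graph: for $n\ge 1$, $G_n$ is the simple graph whose vertices are the integer partitions of $n$; two distinct partitions are adjacent if one is obtained from the other by an elementary transfer of one unit from one part to another (subtract $1$ from one part and add $1$ to another part), followed by reordering. Here the receiving part may be a zero part (so a new part $1$ may be created), and parts that become $0$ are discarded. $\deg(\lambda)$ is the degree of $\lambda$ in $G_n$, $\Delta_n:=\max_{\lambda\vdash n}\deg(\lambda)$, $M_n:=\{\lambda\vdash n:\deg(\lambda)=\Delta_n\}$, $\Pi_n:=\{(A(\lambda),B(\lambda)):\lambda\in M_n\}$, $M_n^{(a,b)}:=\{\lambda\in M_n:(A(\lambda),B(\lambda))=(a,b)\}$, and $m_n^{\mathrm{sc}}:=|\{\lambda\in M_n:\lambda=\lambda'\}|$, where $\lambda'$ is the conjugate partition. *)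

theory Defs
  imports Main "HOL-Library.Multiset"
begin

definition triangular :: "nat \<Rightarrow> nat" where
  "triangular m = m * (m + 1) div 2"

text \<open>A partition of \<open>n\<close> is the multiset of its (positive) parts.\<close>

definition partitions :: "nat \<Rightarrow> nat multiset set" where
  "partitions n = {p. 0 \<notin># p \<and> sum_mset p = n}"

lemma finite_partitions: "finite (partitions n)"
proof -
  have "partitions n \<subseteq> mset ` {xs. set xs \<subseteq> {..n} \<and> length xs \<le> n}"
  proof
    fix p assume p: "p \<in> partitions n"
    obtain xs where xs: "p = mset xs" by (metis ex_mset)
    have pos: "0 \<notin> set xs" and sum: "sum_list xs = n"
      using p xs by (auto simp: partitions_def sum_mset_sum_list)
    have "set xs \<subseteq> {..n}"
      using sum member_le_sum_list by fastforce
    moreover have "length ys \<le> sum_list ys" if "0 \<notin> set ys" for ys :: "nat list"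
      using that by (induction ys) auto
    ultimately show "p \<in> mset ` {xs. set xs \<subseteq> {..n} \<and> length xs \<le> n}"
      using pos sum xs by blast
  qed
  then show ?thesis
    by (rule finite_subset) (intro finite_imageI finite_lists_length_le, simp)
qed

text \<open>The distinct part sizes \<open>L\<^sub>1 > \<dots> > L\<^sub>r\<close> are the elements of \<open>set_mset p\<close>, and the multiplicity
  of \<open>L\<close> is \<open>count p L\<close>. The element \<open>0\<close> in the maximum plays the role of \<open>L\<^bsub>r+1\<^esub> = 0\<close>, so that
  the gap below the smallest part size is that size itself.\<close>

definition gap :: "nat multiset \<Rightarrow> nat \<Rightarrow> nat" where
  "gap p L = L - Max (insert 0 {K \<in> set_mset p. K < L})"

definition A_stat :: "nat multiset \<Rightarrow> nat" where
  "A_stat p = card {L \<in> set_mset p. gap p L > 1}"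

definition B_stat :: "nat multiset \<Rightarrow> nat" where
  "B_stat p = card {L \<in> set_mset p. count p L > 1}"

text \<open>The donor \<open>x\<close> is a part of \<open>p\<close>. The receiver \<open>y\<close> is another part of \<open>p\<close> (possibly of equal
  size) or the single zero part adjoined to \<open>p\<close>. Parts that are zero afterwards are discarded.\<close>

definition transfer :: "nat multiset \<Rightarrow> nat multiset \<Rightarrow> bool" where
  "transfer p q \<longleftrightarrow> (\<exists>x y. x \<in># p \<and> y \<in># add_mset 0 p - {#x#} \<and>
     q = filter_mset (\<lambda>z. z > 0) (add_mset 0 p - {#x, y#} + {#x - 1, y + 1#}))"

definition adjacent :: "nat multiset \<Rightarrow> nat multiset \<Rightarrow> bool" where
  "adjacent p q \<longleftrightarrow> p \<noteq> q \<and> (transfer p q \<or> transfer q p)"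

definition degree :: "nat \<Rightarrow> nat multiset \<Rightarrow> nat" where
  "degree n p = card {q \<in> partitions n. adjacent p q}"

definition max_degree :: "nat \<Rightarrow> nat" where
  "max_degree n = Max (degree n ` partitions n)"

definition maximizers :: "nat \<Rightarrow> nat multiset set" where
  "maximizers n = {p \<in> partitions n. degree n p = max_degree n}"

definition profiles :: "nat \<Rightarrow> (nat \<times> nat) set" where
  "profiles n = (\<lambda>p. (A_stat p, B_stat p)) ` maximizers n"

definition maximizers_with :: "nat \<Rightarrow> nat \<times> nat \<Rightarrow> nat multiset set" where
  "maximizers_with n ab = {p \<in> maximizers n. (A_stat p, B_stat p) = ab}"

text \<open>The \<open>j\<close>-th part of the conjugate is the number of parts that are at least \<open>j\<close>, for \<open>j\<close> from
  \<open>1\<close> up to the largest part.\<close>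

definition conjugate :: "nat multiset \<Rightarrow> nat multiset" where
  "conjugate p =
     {# size {#x \<in># p. j \<le> x#}. j \<in># mset_set {1..Max (insert 0 (set_mset p))} #}"

definition self_conjugate_maximizers :: "nat \<Rightarrow> nat" where
  "self_conjugate_maximizers n = card {p \<in> maximizers n. p = conjugate p}"

end

theory Submission
  imports Defs
begin

text \<open>Write \<open>r\<close> for the number of distinct parts of \<open>p\<close>. The neighbours of \<open>p\<close> correspond to the
  pairs (donor size, receiver size), except that a receiver one below the donor gives back \<open>p\<close> and
  that donor and receiver can only have the same size if this size is repeated. Hence
  \<open>deg p = r (r - 1) + A + B\<close>. Splitting \<open>p\<close> into its set of part sizes, the set of
  repeated part sizes and a remainder gives \<open>T\<^sub>r + T\<^sub>A + T\<^sub>B \<le> n\<close>, with equality for exactly one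
  partition for given \<open>r\<close>, \<open>A\<close> and \<open>B\<close>. For \<open>n = T\<^sub>s + 4\<close> with \<open>s \<ge> 4\<close> this forces \<open>r \<le> s\<close>; the
  case \<open>r < s\<close> gives degree at most \<open>s (s - 1)\<close>, and for \<open>r = s\<close> the inequality \<open>T\<^sub>A + T\<^sub>B \<le> 4\<close>
  gives \<open>A + B \<le> 3\<close>, attained only at \<open>(2, 1)\<close> and \<open>(1, 2)\<close>, both of which are equality cases.\<close>

section \<open>The degree formula\<close>

definition move :: "nat multiset \<Rightarrow> nat \<Rightarrow> nat \<Rightarrow> nat multiset" where
  "move p x y = filter_mset (\<lambda>z. z > 0) (add_mset 0 p - {#x, y#} + {#x - 1, y + 1#})"

lemma transfer_iff_move:
  "transfer p q \<longleftrightarrow> (\<exists>x y. x \<in># p \<and> y \<in># add_mset 0 p - {#x#} \<and> q = move p x y)"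
  by (simp add: transfer_def move_def)

text \<open>Naming the untouched parts \<open>m\<close> avoids multiset difference: a move replaces
  \<open>{#x, y#}\<close> by \<open>{#x - 1, y + 1#}\<close> over the same \<open>m\<close>.\<close>

lemma move_split:
  assumes "x \<in># p" "y \<in># add_mset 0 p - {#x#}"
  obtains m where "add_mset 0 p = m + {#x, y#}"
    "move p x y = filter_mset (\<lambda>z. z > 0) (m + {#x - 1, y + 1#})"
proof
  have "add_mset 0 p - {#x, y#} = add_mset 0 p - {#x#} - {#y#}"
    by (simp add: add_mset_commute)
  then have "add_mset y (add_mset 0 p - {#x, y#}) = add_mset 0 p - {#x#}"
    using insert_DiffM[OF assms(2)] by argo
  moreover have "add_mset x (add_mset 0 p - {#x#}) = add_mset 0 p"
    using assms(1) by (intro insert_DiffM) simp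
  ultimately have "add_mset x (add_mset y (add_mset 0 p - {#x, y#})) = add_mset 0 p"
    by argo
  then show "add_mset 0 p = (add_mset 0 p - {#x, y#}) + {#x, y#}" by simp
qed (simp add: move_def)

lemma transfer_iff:
  assumes "0 \<notin># p"
  shows "transfer p q \<longleftrightarrow> (\<exists>m x y. x > 0 \<and> add_mset 0 p = m + {#x, y#} \<and>
    q = filter_mset (\<lambda>z. z > 0) (m + {#x - 1, y + 1#}))"
proof
  assume "transfer p q"
  then obtain x y where xy: "x \<in># p" "y \<in># add_mset 0 p - {#x#}" and q: "q = move p x y"
    by (auto simp: transfer_iff_move)
  have "x > 0" using xy assms by (metis gr0I)
  then show "\<exists>m x y. x > 0 \<and> add_mset 0 p = m + {#x, y#} \<and>
      q = filter_mset (\<lambda>z. z > 0) (m + {#x - 1, y + 1#})"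
    using move_split[OF xy] q by metis
next
  assume "\<exists>m x y. x > 0 \<and> add_mset 0 p = m + {#x, y#} \<and>
    q = filter_mset (\<lambda>z. z > 0) (m + {#x - 1, y + 1#})"
  then obtain m x y where x: "x > 0" and p: "add_mset 0 p = m + {#x, y#}"
    and q: "q = filter_mset (\<lambda>z. z > 0) (m + {#x - 1, y + 1#})" by blast
  have "x \<in># add_mset 0 p" by (simp add: p)
  then have "x \<in># p" using x by simp
  moreover have "y \<in># add_mset 0 p - {#x#}" by (simp add: p)
  moreover have "q = move p x y" by (simp add: p q move_def)
  ultimately show "transfer p q" unfolding transfer_iff_move by blast
qed

text \<open>A transfer is undone by taking \<open>y + 1\<close> as donor and \<open>x - 1\<close> as
  receiver.\<close>

lemma transfer_sym:
  assumes "0 \<notin># p" "transfer p q"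
  shows "transfer q p"
proof -
  let ?F = "filter_mset (\<lambda>z::nat. z > 0)"
  from assms obtain m x y where x: "x > 0" and p: "add_mset 0 p = m + {#x, y#}"
    and q: "q = ?F (m + {#x - 1, y + 1#})" by (auto simp: transfer_iff)
  \<comment> \<open>\<open>add_mset 0 q\<close> has exactly one zero: for \<open>x = 1\<close> it is
    the receiver \<open>x - 1\<close>, otherwise it belongs to the untouched parts.\<close>
  define m' where "m' = (if x = 1 then ?F m else add_mset 0 (?F m))"
  have "?F p = p"
    using assms(1) by (intro filter_mset_eq_conv[THEN iffD2]) (auto intro: gr0I)
  then have "p = ?F (m + {#x, y#})" using p by (metis filter_mset_add_mset less_irrefl)
  then have "p = ?F (m' + {#y + 1 - 1, (x - 1) + 1#})"
    using x by (auto simp: m'_def filter_filter_mset)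
  moreover have "add_mset 0 q = m' + {#y + 1, x - 1#}"
    using x by (auto simp: m'_def q)
  moreover have "0 \<notin># q" by (simp add: q)
  ultimately show ?thesis
    unfolding transfer_iff[OF \<open>0 \<notin># q\<close>]
    by (intro exI[of _ m'] exI[of _ "y + 1"] exI[of _ "x - 1"]) simp
qed

definition moves :: "nat multiset \<Rightarrow> (nat \<times> nat) set" where
  "moves p = {(x, y). x \<in># p \<and> y \<in># add_mset 0 p - {#x#} \<and> x \<noteq> y + 1}"

text \<open>The number of parts that are at least \<open>k\<close> drops by one at \<open>k = x\<close> and grows by one at
  \<open>k = y + 1\<close>, so the result of a move determines donor and receiver.\<close>

lemma move_count_ge:
  assumes "0 \<notin># p" "x \<in># p" "y \<in># add_mset 0 p - {#x#}" "k > 0"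
  shows "size {#z \<in># move p x y. k \<le> z#} + of_bool (k = x)
    = size {#z \<in># p. k \<le> z#} + of_bool (k = y + 1)"
proof -
  obtain m where p: "add_mset 0 p = m + {#x, y#}"
    and q: "move p x y = filter_mset (\<lambda>z. z > 0) (m + {#x - 1, y + 1#})"
    using move_split assms by blast
  have "{#z \<in># p. k \<le> z#} = {#z \<in># add_mset 0 p. k \<le> z#}" using \<open>k > 0\<close> by simp
  moreover have "{#z \<in># move p x y. k \<le> z#} = {#z \<in># m + {#x - 1, y + 1#}. k \<le> z#}"
    unfolding q filter_filter_mset using \<open>k > 0\<close> by (intro filter_mset_cong) auto
  moreover have "x > 0" using assms by (metis gr0I)
  ultimately show ?thesis unfolding p by (auto simp: of_bool_def)
qed

lemma inj_on_move:
  assumes "0 \<notin># p"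
  shows "inj_on (\<lambda>(x, y). move p x y) (moves p)"
proof (rule inj_onI, clarify)
  fix x y x' y' assume xy: "(x, y) \<in> moves p" and xy': "(x', y') \<in> moves p"
    and eq: "move p x y = move p x' y'"
  have pos: "x > 0" using xy assms by (auto simp: moves_def intro: gr0I)
  let ?N = "\<lambda>q k. size {#z \<in># q. k \<le> z#}"
  have D: "of_bool (k = x) + of_bool (k = y' + 1) = (of_bool (k = x') + of_bool (k = y + 1) :: nat)"
    if "k > 0" for k
  proof -
    have "?N (move p x y) k + of_bool (k = x) = ?N p k + of_bool (k = y + 1)"
      "?N (move p x' y') k + of_bool (k = x') = ?N p k + of_bool (k = y' + 1)"
      using move_count_ge[OF assms] xy xy' that unfolding moves_def by blast+
    then show ?thesis unfolding eq by linarith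
  qed
  \<comment> \<open>As \<open>x \<noteq> y + 1\<close>, the instance \<open>k = x\<close> forces
    \<open>x = x'\<close> and the instance \<open>k = y + 1\<close> forces
    \<open>y = y'\<close>.\<close>
  show "x = x' \<and> y = y'"
    using D[of x] D[of "y + 1"] pos xy xy' by (auto simp: moves_def of_bool_def split: if_splits)
qed

lemma move_in_partitions:
  assumes "p \<in> partitions n" "x \<in># p" "y \<in># add_mset 0 p - {#x#}"
  shows "move p x y \<in> partitions n"
proof -
  have "x > 0" using assms by (auto simp: partitions_def intro: gr0I)
  obtain m where p: "add_mset 0 p = m + {#x, y#}"
    and q: "move p x y = filter_mset (\<lambda>z. z > 0) (m + {#x - 1, y + 1#})"
    using move_split assms by blast
  have sum_filter: "sum_mset (filter_mset (\<lambda>z. z > 0) M) = sum_mset M" for M :: "nat multiset"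
    by (induction M) auto
  have "sum_mset (add_mset 0 p) = sum_mset m + x + y" unfolding p by simp
  then have "sum_mset (move p x y) = n"
    unfolding q sum_filter using assms(1) \<open>x > 0\<close> by (simp add: partitions_def)
  moreover have "0 \<notin># move p x y" unfolding q by simp
  ultimately show ?thesis by (simp add: partitions_def)
qed

lemma neighbours_eq:
  assumes "p \<in> partitions n"
  shows "{q \<in> partitions n. adjacent p q} = (\<lambda>(x, y). move p x y) ` moves p"
proof (intro equalityI subsetI)
  have p0: "0 \<notin># p" using assms by (simp add: partitions_def)
  fix q
  {
    assume "q \<in> {q \<in> partitions n. adjacent p q}"
    then have q: "q \<in> partitions n" "p \<noteq> q" "transfer p q \<or> transfer q p"
      by (auto simp: adjacent_def)
    then have "transfer p q" using transfer_sym by (auto simp: partitions_def)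
    then obtain x y where xy: "x \<in># p" "y \<in># add_mset 0 p - {#x#}" "q = move p x y"
      by (auto simp: transfer_iff_move)
    have "x \<noteq> y + 1"
    proof
      assume x: "x = y + 1"
      obtain m where m: "add_mset 0 p = m + {#x, y#}"
        "move p x y = filter_mset (\<lambda>z. z > 0) (m + {#x - 1, y + 1#})"
        using move_split xy by blast
      have "q = filter_mset (\<lambda>z. z > 0) (add_mset 0 p)"
        unfolding xy m by (simp add: x)
      also have "\<dots> = p" using p0 by (auto simp: filter_mset_eq_conv intro: gr0I)
      finally show False using q by simp
    qed
    then show "q \<in> (\<lambda>(x, y). move p x y) ` moves p" using xy by (auto simp: moves_def)
  next
    assume "q \<in> (\<lambda>(x, y). move p x y) ` moves p"
    then obtain x y where xy: "x \<in># p" "y \<in># add_mset 0 p - {#x#}" "x \<noteq> y + 1"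
      and q: "q = move p x y" by (auto simp: moves_def)
    have "x > 0" using xy p0 by (metis gr0I)
    \<comment> \<open>Since \<open>x \<noteq> y + 1\<close>, the number of parts that are at least
      \<open>x\<close> drops by one.\<close>
    then have "p \<noteq> q"
      using move_count_ge[OF p0 xy(1,2), of x] xy(3) q by auto
    moreover have "transfer p q" unfolding transfer_iff_move using xy q by blast
    ultimately show "q \<in> {q \<in> partitions n. adjacent p q}"
      using move_in_partitions[OF assms xy(1,2)] q by (simp add: adjacent_def)
  }
qed

section \<open>Gaps and the number of moves\<close>

text \<open>The condition \<open>gap p L > 1\<close> freed of \<open>Max\<close>: the starts of
  maximal runs of consecutive integers, where a run from 1 is not counted because 0 is
  adjoined.\<close>

definition gaps :: "nat set \<Rightarrow> nat set" where
  "gaps S = {x \<in> S. x - 1 \<notin> insert 0 S}"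

lemma gaps_subset: "gaps S \<subseteq> S"
  by (auto simp: gaps_def)

lemma A_stat_eq:
  assumes "0 \<notin># p"
  shows "A_stat p = card (gaps (set_mset p))"
proof -
  have "gap p L > 1 \<longleftrightarrow> L - 1 \<notin> insert 0 (set_mset p)" if L: "L \<in># p" for L
  proof -
    let ?K = "insert 0 {K \<in> set_mset p. K < L}"
    have pos: "L > 0" using L assms by (metis gr0I)
    have M: "Max ?K \<in> ?K" by (rule Max_in) auto
    have "\<forall>K\<in>?K. K < L" using pos by blast
    then have "Max ?K < L" using M by (rule bspec)
    show ?thesis
    proof
      assume g: "gap p L > 1"
      show "L - 1 \<notin> insert 0 (set_mset p)"
      proof
        assume "L - 1 \<in> insert 0 (set_mset p)"
        then have "L - 1 \<in> ?K" using pos by auto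
        then have "L - 1 \<le> Max ?K" by (intro Max_ge) auto
        then show False using g by (simp add: gap_def)
      qed
    next
      assume "L - 1 \<notin> insert 0 (set_mset p)"
      then have "Max ?K \<noteq> L - 1" using M by auto
      then show "gap p L > 1" unfolding gap_def using \<open>Max ?K < L\<close> by linarith
    qed
  qed
  then have "{L \<in> set_mset p. gap p L > 1} = gaps (set_mset p)"
    unfolding gaps_def by blast
  then show ?thesis unfolding A_stat_def by (rule arg_cong)
qed

lemma A_stat_le: "A_stat p \<le> card (set_mset p)"
  unfolding A_stat_def by (rule card_mono) auto

lemma B_stat_le: "B_stat p \<le> card (set_mset p)"
  unfolding B_stat_def by (rule card_mono) auto

text \<open>With r sizes there are r (r + 1) pairs of a donor size and a receiver size or zero. Of
  these, r - A have the receiver one below the donor, and r - B ask an unrepeated size to be both.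
  Adding 2 r on the left avoids truncated subtraction.\<close>

lemma degree_eq:
  assumes "p \<in> partitions n"
  shows "degree n p + 2 * card (set_mset p)
    = card (set_mset p) * (card (set_mset p) + 1) + A_stat p + B_stat p"
proof -
  have p0: "0 \<notin># p" using assms by (simp add: partitions_def)
  let ?S = "set_mset p"
  let ?P = "(\<lambda>x. (x, x - 1)) ` (?S - gaps ?S)"
  let ?Q = "(\<lambda>x. (x, x)) ` (?S - {x \<in> ?S. count p x > 1})"
  have pos: "x > 0" if "x \<in># p" for x using that p0 by (metis gr0I)
  have moves: "moves p = ?S \<times> insert 0 ?S - (?P \<union> ?Q)"
  proof (intro set_eqI, clarify)
    fix x y
    have "y \<in># add_mset 0 p - {#x#} \<longleftrightarrow> y \<in> insert 0 ?S \<and> (y = x \<longrightarrow> count p x > 1)" if "x \<in># p"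
      using pos[OF that] that
      by (auto simp: in_diff_count not_in_iff simp flip: count_greater_zero_iff)
    moreover have "(x, y) \<in> ?P \<longleftrightarrow> x = y + 1" if "x \<in># p" "y \<in> insert 0 ?S"
      using that pos[of x] by (auto simp: gaps_def image_iff)
    moreover have "(x, y) \<in> ?Q \<longleftrightarrow> x = y \<and> \<not> count p x > 1" if "x \<in># p"
      using that by (auto simp: image_iff)
    ultimately show "(x, y) \<in> moves p \<longleftrightarrow> (x, y) \<in> ?S \<times> insert 0 ?S - (?P \<union> ?Q)"
      unfolding moves_def Diff_iff Un_iff mem_Sigma_iff mem_Collect_eq case_prod_conv by blast
  qed
  have "?P \<inter> ?Q = {}" using pos by force
  then have "card (?P \<union> ?Q) = card ?P + card ?Q" by (intro card_Un_disjoint) auto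
  moreover have "card ?P = card ?S - A_stat p"
    using gaps_subset[of ?S] finite_subset[OF gaps_subset[of ?S]]
    by (subst card_image) (auto simp: inj_on_def card_Diff_subset A_stat_eq[OF p0])
  moreover have "card ?Q = card ?S - B_stat p"
    unfolding B_stat_def
    by (subst card_image, simp add: inj_on_def, subst card_Diff_subset) auto
  ultimately have PQ: "card (?P \<union> ?Q) + A_stat p + B_stat p = 2 * card ?S"
    using A_stat_le[of p] B_stat_le[of p] by linarith
  have sub: "?P \<union> ?Q \<subseteq> ?S \<times> insert 0 ?S"
    by (auto simp: gaps_def)
  have "card (moves p) + card (?P \<union> ?Q) = card (?S \<times> insert 0 ?S)"
    unfolding moves using sub finite_subset[OF sub] card_mono[OF _ sub] by (simp add: card_Diff_subset)
  also have "\<dots> = card ?S * (card ?S + 1)"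
    using p0 by (simp add: card_cartesian_product)
  finally have "card (moves p) + 2 * card ?S = card ?S * (card ?S + 1) + A_stat p + B_stat p"
    using PQ by linarith
  then show ?thesis
    unfolding degree_def neighbours_eq[OF assms] by (simp add: card_image inj_on_move[OF p0])
qed

section \<open>Extremal partitions\<close>

lemma triangular_0 [simp]: "triangular 0 = 0"
  by (simp add: triangular_def)

lemma triangular_Suc [simp]: "triangular (Suc m) = triangular m + Suc m"
  by (simp add: triangular_def)

lemma mono_triangular: "mono triangular"
  unfolding triangular_def by (intro monoI div_le_mono mult_le_mono) auto

text \<open>For \<open>a \<le> s\<close> this is \<open>{1..s}\<close> with its top \<open>a\<close>
  elements raised by 1, ..., \<open>a\<close>, so that each of them starts a new run.\<close>

definition staircase :: "nat \<Rightarrow> nat \<Rightarrow> nat set" where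
  "staircase s a = {1..s - a} \<union> (\<lambda>i. s - a + 2 * i) ` {1..a}"

lemma staircase_0 [simp]: "staircase s 0 = {1..s}"
  by (simp add: staircase_def)

lemma staircase_Suc:
  "a \<le> s \<Longrightarrow> staircase (Suc s) (Suc a) = insert (Suc s + Suc a) (staircase s a)"
  by (auto simp: staircase_def atLeastAtMostSuc_conv)

text \<open>A new maximum is the predecessor of no element, so only its own status matters.\<close>

lemma gaps_insert_max:
  assumes "\<forall>x\<in>S. x < m" "m > 0"
  shows "gaps (insert m S) = (if m - 1 \<in> insert 0 S then gaps S else insert m (gaps S))"
proof -
  have "x - 1 \<in> insert 0 (insert m S) \<longleftrightarrow> x - 1 \<in> insert 0 S" if "x \<in> insert m S" for x
  proof -
    have "x \<le> m" using that assms(1) by auto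
    then have "x - 1 \<noteq> m" using assms(2) by linarith
    then show ?thesis by blast
  qed
  then have "gaps (insert m S) = {x \<in> insert m S. x - 1 \<notin> insert 0 S}"
    unfolding gaps_def by blast
  then show ?thesis unfolding gaps_def by auto
qed

lemma card_gaps_le: "finite S \<Longrightarrow> card (gaps S) \<le> card S"
  by (simp add: card_mono gaps_subset)

text \<open>Elements are added in increasing order. The bound on the maximum makes each new element
  at least the new cardinality plus the new number of gaps, which covers the growth of the
  triangular numbers.\<close>

lemma staircase_minimal:
  assumes "finite S" "0 \<notin> S"
  shows "card S + card (gaps S) \<le> Max (insert 0 S)"
    and "triangular (card S) + triangular (card (gaps S)) \<le> \<Sum>S"
    and "\<Sum>S = triangular (card S) + triangular (card (gaps S)) \<Longrightarrow>
      S = staircase (card S) (card (gaps S))"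
proof -
  have "card S + card (gaps S) \<le> Max (insert 0 S)
    \<and> triangular (card S) + triangular (card (gaps S)) \<le> \<Sum>S
    \<and> (\<Sum>S = triangular (card S) + triangular (card (gaps S)) \<longrightarrow>
      S = staircase (card S) (card (gaps S)))"
    using assms
  proof (induction S rule: finite_linorder_max_induct)
    case empty
    then show ?case by (simp add: gaps_def)
  next
    case (insert m S)
    then have IH: "card S + card (gaps S) \<le> Max (insert 0 S)"
      "triangular (card S) + triangular (card (gaps S)) \<le> \<Sum>S"
      "\<Sum>S = triangular (card S) + triangular (card (gaps S)) \<Longrightarrow>
        S = staircase (card S) (card (gaps S))"
      by auto
    have m: "m > 0" "m \<notin> S" using insert by auto
    have fin: "finite (gaps S)" "m \<notin> gaps S"
      using insert.hyps gaps_subset m by (auto intro: finite_subset)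
    have M: "Max (insert 0 S) \<in> insert 0 S" using insert.hyps by (intro Max_in) auto
    have less: "Max (insert 0 S) < m" using M insert.hyps m by auto
    then have Max: "Max (insert 0 (insert m S)) = m"
      using insert.hyps by (subst insert_commute, subst Max_insert) auto
    note gaps = gaps_insert_max[OF insert.hyps(2) m(1)]
    show ?case
    proof (cases "m - 1 \<in> insert 0 S")
      case True
      have g: "gaps (insert m S) = gaps S" using True gaps by simp
      have c: "card (insert m S) = Suc (card S)" "\<Sum>(insert m S) = m + \<Sum>S"
        using m insert.hyps by simp_all
      have le: "Suc (card S) + card (gaps S) \<le> m" using IH(1) less by linarith
      have "insert m S = staircase (Suc (card S)) (card (gaps S))"
        if "m + \<Sum>S = triangular (card S) + Suc (card S) + triangular (card (gaps S))"
      proof -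
        \<comment> \<open>Without a new gap the right-hand side grows only by
          \<open>Suc (card S)\<close>, while \<open>m\<close> is larger by at least the number of
          gaps; equality thus leaves no gaps.\<close>
        have "card (gaps S) = 0" "m = Suc (card S)"
          "\<Sum>S = triangular (card S) + triangular (card (gaps S))"
          using that IH(2) le by linarith+
        then show ?thesis using IH(3) by (simp add: atLeastAtMostSuc_conv)
      qed
      then show ?thesis
        unfolding Max g c triangular_Suc using le IH(2) by linarith
    next
      case False
      \<comment> \<open>The missing predecessor pushes \<open>m\<close> up by two, paying for one
        element and one gap.\<close>
      then have "Max (insert 0 S) + 2 \<le> m" using M less by (cases "Max (insert 0 S) = m - 1") auto
      then have le: "Suc (card S) + Suc (card (gaps S)) \<le> m" using IH(1) by simp
      have "insert m S = staircase (Suc (card S)) (Suc (card (gaps S)))"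
        if "m + \<Sum>S = triangular (card S) + Suc (card S) + (triangular (card (gaps S)) + Suc (card (gaps S)))"
      proof -
        have "m = Suc (card S) + Suc (card (gaps S))"
          "\<Sum>S = triangular (card S) + triangular (card (gaps S))"
          using that IH(2) le by linarith+
        then show ?thesis
          using IH(3) staircase_Suc[OF card_gaps_le[OF insert.hyps(1)]] by simp
      qed
      moreover have "gaps (insert m S) = insert m (gaps S)" using False gaps by simp
      then have g: "card (gaps (insert m S)) = Suc (card (gaps S))" using fin by simp
      moreover have c: "card (insert m S) = Suc (card S)" "\<Sum>(insert m S) = m + \<Sum>S"
        using m insert.hyps by simp_all
      ultimately show ?thesis
        unfolding Max g c triangular_Suc using le IH(2) by linarith
    qed
  qed
  then show "card S + card (gaps S) \<le> Max (insert 0 S)"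
    "triangular (card S) + triangular (card (gaps S)) \<le> \<Sum>S"
    "\<Sum>S = triangular (card S) + triangular (card (gaps S)) \<Longrightarrow>
      S = staircase (card S) (card (gaps S))"
    by auto
qed

lemma finite_staircase [simp]: "finite (staircase s a)"
  by (simp add: staircase_def)

lemma staircase_pos: "x \<in> staircase s a \<Longrightarrow> x > 0"
  by (auto simp: staircase_def)

lemma staircase_le:
  assumes "a \<le> s" "x \<in> staircase s a"
  shows "x \<le> s + a"
  using assms by (auto simp: staircase_def)

lemma staircase_attained:
  assumes "a \<le> s"
  shows "card (staircase s a) = s" and "card (gaps (staircase s a)) = a"
    and "\<Sum>(staircase s a) = triangular s + triangular a"
proof -
  have "card (staircase s a) = s \<and> card (gaps (staircase s a)) = a
    \<and> \<Sum>(staircase s a) = triangular s + triangular a"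
    using assms
  proof (induction a arbitrary: s)
    case 0
    have "\<Sum>{1..s} = triangular s" by (induction s) (simp_all add: atLeastAtMostSuc_conv)
    moreover have "gaps {1..s} = {}" by (auto simp: gaps_def)
    ultimately show ?case by simp
  next
    case (Suc a)
    then obtain t where s: "s = Suc t" "a \<le> t" by (cases s) auto
    let ?m = "Suc t + Suc a"
    \<comment> \<open>The new top element is at least 2 above all others, hence a new gap.\<close>
    have less: "x < ?m - 1" if "x \<in> staircase t a" for x
      using staircase_le[OF s(2) that] by simp
    then have "?m \<notin> staircase t a" "?m - 1 \<notin> insert 0 (staircase t a)"
      by force+
    moreover have "gaps (insert ?m (staircase t a)) = insert ?m (gaps (staircase t a))"
      using gaps_insert_max[of "staircase t a" ?m] calculation(2) less by fastforce
    moreover have "finite (gaps (staircase t a))" "?m \<notin> gaps (staircase t a)"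
      using gaps_subset[of "staircase t a"] calculation(1) finite_staircase
      by (blast intro: finite_subset)+
    ultimately show ?case
      using Suc.IH[OF s(2)] unfolding s(1) staircase_Suc[OF s(2)] by simp
  qed
  then show "card (staircase s a) = s" "card (gaps (staircase s a)) = a"
    "\<Sum>(staircase s a) = triangular s + triangular a" by auto
qed

section \<open>Partitions of minimal sum\<close>

definition extremal :: "nat \<Rightarrow> nat \<Rightarrow> nat \<Rightarrow> nat multiset" where
  "extremal s a b = mset_set (staircase s a) + mset_set {1..b}"

lemma sum_mset_mset_set: "finite S \<Longrightarrow> sum_mset (mset_set S) = \<Sum>S"
  by (simp add: sum_unfold_sum_mset)

text \<open>One copy of each size sums to at least T_r + T_A, a second copy of each repeated size to
  at least T_B, and the rest \<open>m\<close> is nonnegative. Equality makes every one of these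
  estimates tight.\<close>

lemma partition_sum_ge:
  assumes "0 \<notin># p"
  shows "triangular (card (set_mset p)) + triangular (A_stat p) + triangular (B_stat p) \<le> sum_mset p"
    and "sum_mset p = triangular (card (set_mset p)) + triangular (A_stat p) + triangular (B_stat p)
      \<Longrightarrow> p = extremal (card (set_mset p)) (A_stat p) (B_stat p)"
proof -
  let ?S = "set_mset p"
  let ?U = "{x \<in> set_mset p. count p x > 1}"
  have B: "card ?U = B_stat p" by (simp add: B_stat_def)
  have fin: "finite ?U" by simp
  have "mset_set ?S + mset_set ?U \<subseteq># p"
    by (rule mset_subset_eqI) (simp add: count_mset_set' Suc_le_eq)
  then obtain m where m: "p = mset_set ?S + mset_set ?U + m"
    by (metis subset_mset.add_diff_inverse)
  then have sum: "sum_mset p = \<Sum>?S + \<Sum>?U + sum_mset m"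
    using fin by (metis finite_set_mset sum_mset.union sum_mset_mset_set)
  have S: "triangular (card ?S) + triangular (A_stat p) \<le> \<Sum>?S"
    "\<Sum>?S = triangular (card ?S) + triangular (A_stat p) \<Longrightarrow> ?S = staircase (card ?S) (A_stat p)"
    using staircase_minimal(2,3)[of ?S] assms by (auto simp: A_stat_eq)
  have U: "triangular (B_stat p) + triangular (card (gaps ?U)) \<le> \<Sum>?U"
    "\<Sum>?U = triangular (B_stat p) + triangular (card (gaps ?U)) \<Longrightarrow>
      ?U = staircase (B_stat p) (card (gaps ?U))"
    using staircase_minimal(2,3)[OF fin] assms B by auto
  show "triangular (card ?S) + triangular (A_stat p) + triangular (B_stat p) \<le> sum_mset p"
    using sum S(1) U(1) by linarith
  assume eq: "sum_mset p = triangular (card ?S) + triangular (A_stat p) + triangular (B_stat p)"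
  \<comment> \<open>The bound for \<open>?U\<close> also counts the gaps of \<open>?U\<close>;
    equality removes them, so the repeated sizes form an initial segment.\<close>
  have "sum_mset m = 0" and S': "?S = staircase (card ?S) (A_stat p)"
    and g: "triangular (card (gaps ?U)) = 0"
    and U': "\<Sum>?U = triangular (B_stat p) + triangular (card (gaps ?U))"
    using sum S U(1) eq by linarith+
  have "card (gaps ?U) = 0" using g by (cases "card (gaps ?U)") auto
  then have U'': "?U = {1..B_stat p}" using U(2)[OF U'] by simp
  have "0 \<notin># m" using assms m by (metis UnI2 set_mset_union)
  then have "m = {#}" using \<open>sum_mset m = 0\<close>
    by (metis multiset_nonemptyE sum_mset_0_iff)
  then show "p = extremal (card ?S) (A_stat p) (B_stat p)"
    unfolding extremal_def using m U'' S' by (metis add.right_neutral)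
qed

text \<open>The hypothesis puts \<open>{1..b}\<close> inside the initial run
  \<open>{1..s - a}\<close>, so doubling these sizes creates no new one.\<close>

lemma extremal_stats:
  assumes "a + b \<le> s"
  shows "set_mset (extremal s a b) = staircase s a"
    and "A_stat (extremal s a b) = a"
    and "B_stat (extremal s a b) = b"
    and "extremal s a b \<in> partitions (triangular s + triangular a + triangular b)"
    and "size (extremal s a b) = s + b"
proof -
  have sub: "{1..b} \<subseteq> staircase s a" using assms by (auto simp: staircase_def)
  show set: "set_mset (extremal s a b) = staircase s a"
    using sub by (auto simp: extremal_def)
  have zero: "0 \<notin># extremal s a b"
    unfolding set using staircase_pos by blast
  show "A_stat (extremal s a b) = a"
    using assms by (simp add: A_stat_eq[OF zero] set staircase_attained)
  have "{x \<in> staircase s a. count (extremal s a b) x > 1} = {1..b}"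
    using sub by (auto simp: extremal_def count_mset_set' split: if_splits)
  then show "B_stat (extremal s a b) = b"
    by (simp add: B_stat_def set)
  have "\<Sum>{1..b} = triangular b" using staircase_attained(3)[of 0 b] by simp
  then show "extremal s a b \<in> partitions (triangular s + triangular a + triangular b)"
    using zero assms staircase_attained(3)[of a s]
    unfolding partitions_def by (simp add: extremal_def sum_mset_mset_set)
  show "size (extremal s a b) = s + b"
    using assms by (simp add: extremal_def staircase_attained)
qed

lemma Max_extremal:
  assumes "a + b \<le> s"
  shows "Max (insert 0 (set_mset (extremal s a b))) = s + a"
proof -
  have "s + a \<in> insert 0 (staircase s a)"
    \<comment> \<open>For \<open>a > 0\<close> the top element is the image of \<open>a\<close>; for
      \<open>a = 0\<close> it is \<open>s\<close>, or the adjoined 0 when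
      \<open>s = 0\<close>.\<close>
    using assms by (cases a) (auto simp: staircase_def intro!: image_eqI[of _ _ a])
  then show ?thesis
    using assms staircase_le[of a s] unfolding extremal_stats(1)[OF assms]
    by (intro Max_eqI) auto
qed

text \<open>A self-conjugate partition thus has as many parts as its largest part, while
  \<open>extremal s a b\<close> with \<open>a + b \<le> s\<close> has \<open>s + b\<close> parts and
  largest part \<open>s + a\<close>.\<close>

lemma size_conjugate: "size (conjugate p) = Max (insert 0 (set_mset p))"
  by (simp add: conjugate_def)

section \<open>The maximizers\<close>

lemma degree_extremal:
  assumes "a + b \<le> s" "n = triangular s + triangular a + triangular b"
  shows "degree n (extremal s a b) + 2 * s = s * (s + 1) + a + b"
  using degree_eq[of "extremal s a b" n] extremal_stats[OF assms(1)] assms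
  by (simp add: staircase_attained)

lemma triangular_sum_le_4:
  assumes "triangular a + triangular b \<le> 4"
  shows "a + b < 3 \<or> (a, b) \<in> {(2, 1), (1, 2)}"
proof -
  \<comment> \<open>\<open>triangular 3 = 6\<close> already exceeds 4; the pair (2, 2) also sums to
    6.\<close>
  have "a < 3" "b < 3"
    using assms monoD[OF mono_triangular, of 3 a] monoD[OF mono_triangular, of 3 b]
    by (auto simp: numeral_3_eq_3 not_less[symmetric])
  then have "a \<in> {0, 1, 2}" "b \<in> {0, 1, 2}" by auto
  then show ?thesis using assms by (auto simp: numeral_2_eq_2)
qed

lemma degree_le:
  assumes "s \<ge> 4" and p: "p \<in> partitions (triangular s + 4)"
  shows "degree (triangular s + 4) p + 2 * s \<le> s * (s + 1) + 3"
    and "degree (triangular s + 4) p + 2 * s = s * (s + 1) + 3 \<Longrightarrow>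
      p \<in> {extremal s 2 1, extremal s 1 2}"
proof -
  let ?n = "triangular s + 4"
  let ?r = "card (set_mset p)"
  have p0: "0 \<notin># p" and sum: "sum_mset p = ?n" using p by (auto simp: partitions_def)
  note deg = degree_eq[OF p]
  note ge = partition_sum_ge[OF p0, unfolded sum]
  have "?r \<le> s"
  proof (rule ccontr)
    assume "\<not> ?r \<le> s"
    \<comment> \<open>More than \<open>s\<close> sizes would cost at least
      \<open>s + 1 \<ge> 5\<close> beyond \<open>triangular s\<close>.\<close>
    then have "triangular (Suc s) \<le> triangular ?r" by (intro monoD[OF mono_triangular]) simp
    then show False using ge(1) assms(1) by simp
  qed
  then consider "?r < s" | "?r = s" by linarith
  then have "degree ?n p + 2 * s \<le> s * (s + 1) + 3 \<and>
    (degree ?n p + 2 * s = s * (s + 1) + 3 \<longrightarrow> p \<in> {extremal s 2 1, extremal s 1 2})"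
  proof cases
    case 1
    then obtain t where t: "s = Suc t" "?r \<le> t" by (cases s) auto
    \<comment> \<open>Here even A = B = r gives degree only r (r + 1) \<le> s (s - 1), three short
      of the bound.\<close>
    have "?r * (?r + 1) \<le> t * (t + 1)" using t by (intro mult_le_mono) auto
    then have "degree ?n p \<le> t * (t + 1)" using deg A_stat_le[of p] B_stat_le[of p] by linarith
    then show ?thesis by (simp add: t)
  next
    case 2
    have T: "triangular (A_stat p) + triangular (B_stat p) \<le> 4" using ge(1) 2 by simp
    show ?thesis
    proof (cases "A_stat p + B_stat p < 3")
      case True
      then show ?thesis using deg 2 by simp
    next
      case False
      then have AB: "(A_stat p, B_stat p) \<in> {(2, 1), (1, 2)}" using triangular_sum_le_4[OF T] by blast
      \<comment> \<open>Both profiles use up the excess exactly, as T_2 + T_1 = 4, so the equality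
        case determines \<open>p\<close>.\<close>
      then have "p = extremal s (A_stat p) (B_stat p)"
        using ge(2) 2 by (auto simp: numeral_2_eq_2)
      then have "p \<in> {extremal s 2 1, extremal s 1 2}" using AB by auto
      then show ?thesis using deg 2 AB by auto
    qed
  qed
  then show "degree ?n p + 2 * s \<le> s * (s + 1) + 3"
    "degree ?n p + 2 * s = s * (s + 1) + 3 \<Longrightarrow> p \<in> {extremal s 2 1, extremal s 1 2}" by auto
qed

lemma maximizers_eq:
  assumes "s \<ge> 4"
  shows "maximizers (triangular s + 4) = {extremal s 2 1, extremal s 1 2}"
proof -
  let ?n = "triangular s + 4"
  let ?E = "{extremal s 2 1, extremal s 1 2}"
  have E: "q \<in> partitions ?n" "degree ?n q + 2 * s = s * (s + 1) + 3" if "q \<in> ?E" for q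
  proof -
    have T: "?n = triangular s + triangular 2 + triangular 1"
      "?n = triangular s + triangular 1 + triangular 2"
      by (simp_all add: triangular_def)
    show "q \<in> partitions ?n"
      using that extremal_stats(4)[of 2 1 s] extremal_stats(4)[of 1 2 s] assms
      unfolding T[symmetric] by auto
    show "degree ?n q + 2 * s = s * (s + 1) + 3"
      using that degree_extremal[OF _ T(1)] degree_extremal[OF _ T(2)] assms by auto
  qed
  have "max_degree ?n = degree ?n (extremal s 2 1)"
    unfolding max_degree_def
  proof (rule Max_eqI)
    fix d assume "d \<in> degree ?n ` partitions ?n"
    then show "d \<le> degree ?n (extremal s 2 1)"
      using degree_le(1)[OF assms] E(2)[of "extremal s 2 1"] by fastforce
  qed (use E finite_partitions in auto)
  then have "max_degree ?n + 2 * s = s * (s + 1) + 3" using E(2) by simp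
  then have "p \<in> maximizers ?n \<longleftrightarrow> p \<in> partitions ?n \<and> degree ?n p + 2 * s = s * (s + 1) + 3" for p
    unfolding maximizers_def by auto
  then show ?thesis using degree_le(2)[OF assms] E by blast
qed

theorem proposition7p2:
  fixes s :: nat
  assumes "s \<ge> 4"
  shows "profiles (triangular s + 4) = {(2, 1), (1, 2)}
    \<and> card (maximizers_with (triangular s + 4) (2, 1)) = 1
    \<and> card (maximizers_with (triangular s + 4) (1, 2)) = 1
    \<and> card (maximizers (triangular s + 4)) = 2
    \<and> self_conjugate_maximizers (triangular s + 4) = 0"
proof -
  let ?p = "extremal s 2 1" and ?q = "extremal s 1 2"
  note M = maximizers_eq[OF assms]
  have stats: "A_stat ?p = 2" "B_stat ?p = 1" "A_stat ?q = 1" "B_stat ?q = 2"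
    using assms by (simp_all add: extremal_stats)
  have "?p \<noteq> ?q" using stats by (metis one_eq_numeral_iff semiring_norm(85))
  have "maximizers_with (triangular s + 4) (2, 1) = {?p}"
    "maximizers_with (triangular s + 4) (1, 2) = {?q}"
    unfolding maximizers_with_def M using stats by auto
  \<comment> \<open>The number of parts and the largest part are \<open>s + 1\<close> and
    \<open>s + 2\<close> for \<open>?p\<close>, and the other way round for
    \<open>?q\<close>.\<close>
  moreover have "?p \<noteq> conjugate ?p" "?q \<noteq> conjugate ?q"
    using size_conjugate[of ?p] size_conjugate[of ?q] Max_extremal[of 2 1 s] Max_extremal[of 1 2 s]
      extremal_stats(5)[of 2 1 s] extremal_stats(5)[of 1 2 s] assms by auto
  then have "{p \<in> maximizers (triangular s + 4). p = conjugate p} = {}"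
    unfolding M by blast
  ultimately show ?thesis
    using \<open>?p \<noteq> ?q\<close> stats by (simp add: profiles_def self_conjugate_maximizers_def M)
qed

end
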